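(* Suppose that $H=(V,E)$ is a hypergraph with a non-trivial edge, and let $I=I(H)\subseteq R=k[x_1,\ldots,x_n]$ be its edge ideal. Then $$\widehat\alpha(I)=\frac{\chi^*(H)}{\chi^*(H)-1},$$ where $\chi^*(H)$ is the fractional chromatic number of the hypergraph $H$.
   Context: $k$ is an algebraically closed field of any characteristic. A hypergraph is an ordered pair $H=(V,E)$ where $V=\{x_1,\ldots,x_n\}$ is the set of vertices and $E$ consists of subsets of $V$ (called edges) such that if $e_i,e_j\in E$ and $e_i\subseteq e_j$, then $e_i=e_j$. A non-trivial edge is an edge that is not just a single isolated vertex, i.e. an edge containing at least two vertices. The edge ideal of $H$ is the squarefree monomial ideal $I(H)=\langle x_{i_1}x_{i_2}\cdots x_{i_t} \mid \{x_{i_1},\ldots,x_{i_t}\}\in E\rangle\subseteq R$. A set $W\subseteq V$ is an independent set of $H$ if $e\not\subseteq W$ for every $e\in E$. Let $W_1,\ldots,W_t$ be all the independent sets of $H$, and let $B$ be the $n\times t$ matrix with $B_{i,j}=1$ if $x_i\in W_j$ and $B_{i,j}=0$ if $x_i\notin W_j$. The fractional chromatic number $\chi^*(H)$ is the optimal value of the linear program: minimize $y_{W_1}+\cdots+y_{W_t}=\mathbf 1^T\mathbf y$ subject to $B\mathbf y\ge\mathbf 1$ and $\mathbf y\ge\mathbf 0$. For a nonzero homogeneous ideal $J\subseteq R$, $\alpha(J)=\min\{d\mid J_d\neq 0\}$ is the smallest degree of a nonzero element of $J$; the $m$-th symbolic power of $J$ is $J^{(m)}=\bigcap_{P\in\mathrm{Ass}(J)}(J^mR_P\cap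 R)$, where $\mathrm{Ass}(J)$ is the set of associated primes of $J$ and $R_P$ is the localization of $R$ at $P$; and the Waldschmidt constant of $J$ is $\widehat\alpha(J)=\lim_{m\to\infty}\alpha(J^{(m)})/m$ (this limit exists). *)

theory Defs
  imports
    Complex_Main
    "HOL-Library.Poly_Mapping"
    "HOL-Library.Extended_Real"
    "HOL-Computational_Algebra.Fraction_Field"
    "HOL-Algebra.Ideal_Product"
    "HOL-Algebra.Algebraic_Closure_Type"
begin

section \<open>Hypergraphs and the fractional chromatic number\<close>

text \<open>
  The vertex set \<open>V = {x\<^sub>1, \<dots>, x\<^sub>n}\<close> is the universe of a finite type \<open>'v\<close>, so a
  hypergraph is given by its edge set. Neither the empty edge nor singleton edges are excluded.
\<close>

definition hypergraph :: "'v set set \<Rightarrow> bool" where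
  "hypergraph E \<longleftrightarrow> (\<forall>e\<in>E. \<forall>f\<in>E. e \<subseteq> f \<longrightarrow> e = f)"

definition nontrivial_edge :: "'v set \<Rightarrow> bool" where
  "nontrivial_edge e \<longleftrightarrow> card e \<ge> 2"

definition independent_sets :: "'v set set \<Rightarrow> 'v set set" where
  "independent_sets E = {W. \<forall>e\<in>E. \<not> e \<subseteq> W}"

definition incidence :: "'v \<Rightarrow> 'v set \<Rightarrow> real" where
  "incidence x W = (if x \<in> W then 1 else 0)"

text \<open>
  A vector \<open>y\<close> of the linear program has one entry \<open>y W\<close> for each independent set \<open>W\<close>;
  its values elsewhere play no role.
\<close>

definition lp_feasible :: "'v::finite set set \<Rightarrow> ('v set \<Rightarrow> real) \<Rightarrow> bool" where
  "lp_feasible E y \<longleftrightarrow>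
     (\<forall>x. (\<Sum>W\<in>independent_sets E. incidence x W * y W) \<ge> 1) \<and>
     (\<forall>W\<in>independent_sets E. y W \<ge> 0)"

text \<open>
  The optimal value is extended-real valued. If \<open>{x} \<in> E\<close> for some vertex \<open>x\<close>, then no
  independent set contains \<open>x\<close>, the program is infeasible, and its optimal value is \<open>\<infinity>\<close>.
  In all other cases the value is finite.
\<close>

definition fractional_chromatic_number :: "'v::finite set set \<Rightarrow> ereal" where
  "fractional_chromatic_number E =
     (INF y\<in>{y. lp_feasible E y}. ereal (\<Sum>W\<in>independent_sets E. y W))"


section \<open>The polynomial ring and edge ideals\<close>

text \<open>
  \<open>R = k[x\<^sub>1, \<dots>, x\<^sub>n]\<close> consists of the finitely supported functions from exponent vectors to
  \<open>k\<close>, with convolution as multiplication. The linear order on the variables is only needed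
  for the library's proof that this is an integral domain.
\<close>

type_synonym ('v, 'k) mpoly = "('v \<Rightarrow>\<^sub>0 nat) \<Rightarrow>\<^sub>0 'k"

definition var :: "'v \<Rightarrow> ('v, 'k::comm_ring_1) mpoly" where
  "var x = Poly_Mapping.single (Poly_Mapping.single x 1) 1"

definition edge_ideal :: "'v::finite set set \<Rightarrow> ('v, 'k::comm_ring_1) mpoly set" where
  "edge_ideal E = Idl\<^bsub>ring_of_type_algebra\<^esub> ((\<lambda>e. \<Prod>x\<in>e. var x) ` E)"

definition homogeneous :: "nat \<Rightarrow> ('v::finite, 'k::zero) mpoly \<Rightarrow> bool" where
  "homogeneous d p \<longleftrightarrow>
     (\<forall>a \<in> Poly_Mapping.keys p. (\<Sum>x\<in>UNIV. Poly_Mapping.lookup a x) = d)"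

definition alpha :: "('v::finite, 'k::zero) mpoly set \<Rightarrow> nat" where
  "alpha J = (LEAST d. \<exists>p\<in>J. homogeneous d p \<and> p \<noteq> 0)"


section \<open>Symbolic powers and the Waldschmidt constant\<close>

definition associated_primes :: "('a, 'b) ring_scheme \<Rightarrow> 'a set \<Rightarrow> 'a set set" where
  "associated_primes R J =
     {P. primeideal P R \<and> (\<exists>f\<in>carrier R. P = {r\<in>carrier R. r \<otimes>\<^bsub>R\<^esub> f \<in> J})}"

text \<open>
  For a prime \<open>P\<close> of an integral domain, the localization is realized as a subring of the
  fraction field.
\<close>

definition localization :: "'a::idom set \<Rightarrow> 'a fract ring" where
  "localization P = ring_of_type_algebra\<lparr>carrier := {Fract a s | a s. s \<notin> P}\<rparr>"

definition extend_contract :: "'a::idom set \<Rightarrow> 'a set \<Rightarrow> 'a set" where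
  "extend_contract P J = {r. Fract r 1 \<in> Idl\<^bsub>localization P\<^esub> ((\<lambda>a. Fract a 1) ` J)}"

definition symbolic_power :: "'a::idom set \<Rightarrow> nat \<Rightarrow> 'a set" where
  "symbolic_power J m =
     (\<Inter>P\<in>associated_primes ring_of_type_algebra J.
        extend_contract P (J [^]\<^bsub>ideals_set ring_of_type_algebra\<^esub> m))"

definition waldschmidt :: "('v::{finite,linorder}, 'k::idom) mpoly set \<Rightarrow> real" where
  "waldschmidt J = lim (\<lambda>m. real (alpha (symbolic_power J m)) / real m)"

end

theory Submission
  imports Defs "HOL-Analysis.Analysis"
begin

text \<open>
  A monomial \<open>x\<^sup>a\<close> lies in the \<open>m\<close>-th symbolic power of \<open>I\<close> iff \<open>a\<close> has weight at least \<open>m\<close> on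
  every vertex cover, because the associated primes of \<open>I\<close> are generated by the minimal vertex
  covers; and the symbolic power is spanned by such monomials. The vertex covers are the complements
  of the independent sets. By the minimax theorem there are a probability vector \<open>p\<close> on the
  vertices, a probability vector \<open>y\<close> on the independent sets and a value \<open>v < 1\<close> such that every
  independent set has \<open>p\<close>-measure at most \<open>v\<close> and every vertex is covered by \<open>y\<close> with probability at
  least \<open>v\<close>. If \<open>v > 0\<close>, then \<open>y / v\<close> and \<open>p / v\<close> are optimal solutions of the program defining
  \<open>\<chi>\<^sup>*(H)\<close> and of its dual, so \<open>\<chi>\<^sup>*(H) = 1 / v\<close>; if \<open>v = 0\<close>, the program is infeasible. Rounding up
  \<open>m p / (1 - v)\<close> gives an exponent of the symbolic power whose degree is minimal up to a bounded
  error, so the Waldschmidt constant is \<open>1 / (1 - v)\<close>.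
\<close>

section \<open>Ideals of a commutative ring type\<close>

lemma ring_of_type_algebra_sel [simp]:
  "carrier ring_of_type_algebra = UNIV"
  "x \<otimes>\<^bsub>ring_of_type_algebra\<^esub> y = x * y"
  "x \<oplus>\<^bsub>ring_of_type_algebra\<^esub> y = x + y"
  "\<zero>\<^bsub>ring_of_type_algebra\<^esub> = 0"
  "\<one>\<^bsub>ring_of_type_algebra\<^esub> = 1"
  by (simp_all add: ring_of_type_algebra_def)

text \<open>Closure under negation comes from multiplication by \<open>- 1\<close>.\<close>

lemma ideal_ring_of_type_algebra_iff:
  fixes J :: "'a::comm_ring_1 set"
  shows "ideal J ring_of_type_algebra \<longleftrightarrow>
    0 \<in> J \<and> (\<forall>a\<in>J. \<forall>b\<in>J. a + b \<in> J) \<and> (\<forall>a\<in>J. \<forall>r. r * a \<in> J)" (is "_ \<longleftrightarrow> ?R")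
proof
  assume "ideal J ring_of_type_algebra"
  then interpret ideal J "ring_of_type_algebra :: 'a ring" .
  show ?R
    using additive_subgroup.zero_closed[OF is_additive_subgroup]
      additive_subgroup.a_closed[OF is_additive_subgroup] I_l_closed by auto
next
  assume J: ?R
  interpret cring "ring_of_type_algebra :: 'a ring" by (rule cring_from_type_algebra)
  show "ideal J ring_of_type_algebra"
  proof (rule idealI)
    show "subgroup J (add_monoid ring_of_type_algebra)"
    proof (rule add.subgroupI)
      fix a assume "a \<in> J"
      hence "- 1 * a \<in> J" using J by blast
      moreover have "\<ominus>\<^bsub>ring_of_type_algebra\<^esub> a = - a"
        by (metis add.inv_equality UNIV_I add.commute left_minus ring_of_type_algebra_sel(1,3,4) a_inv_def)
      ultimately show "\<ominus>\<^bsub>ring_of_type_algebra\<^esub> a \<in> J" by simp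
    qed (use J in auto)
  qed (use J ring_axioms in \<open>auto simp: mult.commute\<close>)
qed

text \<open>The fractions with numerator in \<open>J\<close> and denominator outside
  \<open>P\<close> form an ideal of the localization that contains the image of \<open>J\<close>, so
  the extension of \<open>J\<close> lies inside it, and cross-multiplying gives \<open>s\<close>.
  Conversely, dividing the image of \<open>s * r\<close> by the unit \<open>s\<close> gives back
  \<open>r\<close>.\<close>

lemma extend_contract_iff:
  fixes P J :: "'a::idom set"
  assumes "0 \<in> P" "1 \<notin> P" and mult: "\<And>s t. s \<notin> P \<Longrightarrow> t \<notin> P \<Longrightarrow> s * t \<notin> P"
    and J: "ideal J ring_of_type_algebra"
  shows "r \<in> extend_contract P J \<longleftrightarrow> (\<exists>s. s \<notin> P \<and> s * r \<in> J)"
proof -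
  have nz: "s \<noteq> 0" if "s \<notin> P" for s using that assms(1) by auto
  have J0: "0 \<in> J" and Jadd: "\<And>a b. a \<in> J \<Longrightarrow> b \<in> J \<Longrightarrow> a + b \<in> J"
    and Jmult: "\<And>a r. a \<in> J \<Longrightarrow> r * a \<in> J"
    using J by (auto simp: ideal_ring_of_type_algebra_iff)
  let ?L = "{Fract a s | a s. a \<in> J \<and> s \<notin> P}"
  let ?A = "localization P"
  have car: "carrier ?A = {Fract a s | a s. s \<notin> P}"
    and ops: "\<And>x y. x \<otimes>\<^bsub>?A\<^esub> y = x * y" "\<And>x y. x \<oplus>\<^bsub>?A\<^esub> y = x + y" "\<zero>\<^bsub>?A\<^esub> = 0" "\<one>\<^bsub>?A\<^esub> = 1"
    by (simp_all add: localization_def ring_of_type_algebra_def)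
  interpret F: cring "ring_of_type_algebra :: 'a fract ring" by (rule cring_from_type_algebra)
  have sub: "subring (carrier ?A) (ring_of_type_algebra :: 'a fract ring)"
  proof (rule F.subringI)
    show "carrier ?A \<subseteq> carrier ring_of_type_algebra" by simp
    show "\<one>\<^bsub>ring_of_type_algebra\<^esub> \<in> carrier ?A"
      unfolding car using assms(2) by (auto simp: One_fract_def)
    fix h1 assume h1: "h1 \<in> carrier ?A"
    then obtain a s where as: "h1 = Fract a s" "s \<notin> P" by (auto simp: car)
    have "\<ominus>\<^bsub>ring_of_type_algebra\<^esub> h1 = - h1"
      by (metis F.add.inv_equality UNIV_I add.commute left_minus ring_of_type_algebra_sel(1,3,4) a_inv_def)
    also have "\<dots> = Fract (- a) s" using as by simp
    finally show "\<ominus>\<^bsub>ring_of_type_algebra\<^esub> h1 \<in> carrier ?A" using as by (auto simp: car)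
    fix h2 assume h2: "h2 \<in> carrier ?A"
    then obtain b t where bt: "h2 = Fract b t" "t \<notin> P" by (auto simp: car)
    show "h1 \<otimes>\<^bsub>ring_of_type_algebra\<^esub> h2 \<in> carrier ?A"
      using as bt mult by (auto simp: car)
    have "h1 + h2 = Fract (a * t + b * s) (s * t)" using as bt nz by simp
    thus "h1 \<oplus>\<^bsub>ring_of_type_algebra\<^esub> h2 \<in> carrier ?A"
      using as bt mult by (auto simp: car)
  qed
  have "?A = ring_of_type_algebra\<lparr>carrier := carrier ?A\<rparr>"
    by (simp add: localization_def)
  then have "ring ?A"
    using F.subring_is_ring[OF sub] by simp
  then interpret A: ring ?A .
  have "ideal ?L ?A"
  proof (rule idealI)
    show "ring ?A" by (rule A.ring_axioms)
    show "subgroup ?L (add_monoid ?A)"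
    proof (rule A.add.subgroupI)
      show "?L \<subseteq> carrier ?A" by (auto simp: car)
      show "?L \<noteq> {}" using J0 assms(2) by auto
      fix h1 assume h1: "h1 \<in> ?L"
      then obtain a s where as: "h1 = Fract a s" "a \<in> J" "s \<notin> P" by auto
      have "\<ominus>\<^bsub>?A\<^esub> h1 = - h1"
      proof (rule A.minus_equality)
        have "- h1 = Fract (- a) s" using as by simp
        thus "- h1 \<in> carrier ?A" using as by (auto simp: car)
        show "- h1 \<oplus>\<^bsub>?A\<^esub> h1 = \<zero>\<^bsub>?A\<^esub>" by (simp add: ops)
      qed (use as in \<open>auto simp: car\<close>)
      moreover have "- h1 = Fract (- 1 * a) s" using as by simp
      ultimately show "\<ominus>\<^bsub>?A\<^esub> h1 \<in> ?L"
        using Jmult[OF as(2), of "- 1"] as(3) by auto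
      fix h2 assume "h2 \<in> ?L"
      then obtain b t where bt: "h2 = Fract b t" "b \<in> J" "t \<notin> P" by auto
      have "h1 + h2 = Fract (t * a + s * b) (s * t)" using as bt nz by (simp add: mult.commute)
      moreover have "t * a + s * b \<in> J" using as bt Jadd Jmult by blast
      ultimately show "h1 \<oplus>\<^bsub>?A\<^esub> h2 \<in> ?L"
        using as bt mult unfolding ops by blast
    qed
    fix l x assume "l \<in> ?L" "x \<in> carrier ?A"
    then obtain a s b t where *: "l = Fract a s" "x = Fract b t" "a \<in> J" "s \<notin> P" "t \<notin> P"
      by (auto simp: car)
    have "x * l = Fract (b * a) (t * s)" using * by simp
    moreover have "b * a \<in> J" using * Jmult by blast
    ultimately have "x * l \<in> ?L" using * mult by blast
    thus "x \<otimes>\<^bsub>?A\<^esub> l \<in> ?L" "l \<otimes>\<^bsub>?A\<^esub> x \<in> ?L"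
      unfolding ops by (simp_all add: mult.commute)
  qed
  moreover have "(\<lambda>a. Fract a 1) ` J \<subseteq> ?L" using assms(2) by auto
  ultimately have gen: "Idl\<^bsub>?A\<^esub> ((\<lambda>a. Fract a 1) ` J) \<subseteq> ?L"
    by (rule A.genideal_minimal)
  show ?thesis
  proof
    assume "r \<in> extend_contract P J"
    then obtain a s where *: "Fract r 1 = Fract a s" "a \<in> J" "s \<notin> P"
      using gen unfolding extend_contract_def by blast
    hence "s * r = a" using nz by (simp add: eq_fract mult.commute)
    thus "\<exists>s. s \<notin> P \<and> s * r \<in> J" using * by blast
  next
    assume "\<exists>s. s \<notin> P \<and> s * r \<in> J"
    then obtain s where s: "s \<notin> P" "s * r \<in> J" by blast
    have "Fract r 1 \<in> K" if K: "ideal K ?A" "(\<lambda>a. Fract a 1) ` J \<subseteq> K" for K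
    proof -
      interpret K: ideal K ?A by fact
      have "Fract 1 s \<otimes>\<^bsub>?A\<^esub> Fract (s * r) 1 \<in> K"
        by (rule K.I_l_closed) (use K s in \<open>auto simp: car\<close>)
      moreover have "Fract 1 s * Fract (s * r) 1 = Fract r 1"
        using nz[OF s(1)] by (simp add: eq_fract)
      ultimately show ?thesis by (simp add: ops)
    qed
    thus "r \<in> extend_contract P J"
      by (auto simp: extend_contract_def genideal_def)
  qed
qed

section \<open>Powers of ideals\<close>

lemma ideal_pow_simps:
  "J [^]\<^bsub>ideals_set ring_of_type_algebra\<^esub> (0::nat) = UNIV"
  "J [^]\<^bsub>ideals_set ring_of_type_algebra\<^esub> Suc m =
     ideal_prod ring_of_type_algebra (J [^]\<^bsub>ideals_set ring_of_type_algebra\<^esub> m) J"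
  by (simp_all add: nat_pow_def ideals_set_def)

lemma ideal_pow:
  fixes J :: "'a::comm_ring_1 set"
  assumes "ideal J ring_of_type_algebra"
  shows "ideal (J [^]\<^bsub>ideals_set ring_of_type_algebra\<^esub> (m::nat)) ring_of_type_algebra"
proof (induction m)
  case 0
  show ?case unfolding ideal_pow_simps by (simp add: ideal_ring_of_type_algebra_iff)
next
  case (Suc m)
  interpret cring "ring_of_type_algebra :: 'a ring" by (rule cring_from_type_algebra)
  show ?case using Suc assms unfolding ideal_pow_simps by (rule ideal_prod_is_ideal)
qed

lemma power_mem_ideal_pow:
  fixes J :: "'a::comm_ring_1 set"
  assumes J: "ideal J ring_of_type_algebra" and "a \<in> J [^]\<^bsub>ideals_set ring_of_type_algebra\<^esub> (i::nat)" "b \<in> J"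
  shows "a * b ^ j \<in> J [^]\<^bsub>ideals_set ring_of_type_algebra\<^esub> (i + j)"
proof (induction j)
  case (Suc j)
  have "a * b ^ j \<otimes>\<^bsub>ring_of_type_algebra\<^esub> b \<in> J [^]\<^bsub>ideals_set ring_of_type_algebra\<^esub> (Suc (i + j))"
    unfolding ideal_pow_simps by (rule ideal_prod.prod) (use Suc assms in auto)
  thus ?case by (simp add: mult_ac)
qed (use assms in simp)

lemma prod_power_mem_ideal_pow:
  fixes J :: "'a::comm_ring_1 set"
  assumes J: "ideal J ring_of_type_algebra" and "finite A" "\<And>x. x \<in> A \<Longrightarrow> b x \<in> J"
  shows "(\<Prod>x\<in>A. b x ^ k x) \<in> J [^]\<^bsub>ideals_set ring_of_type_algebra\<^esub> (\<Sum>x\<in>A. k x :: nat)"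
  using assms(2,3)
proof (induction A)
  case empty
  then show ?case unfolding sum.empty ideal_pow_simps by simp
next
  case (insert x A)
  have "(\<Prod>x\<in>A. b x ^ k x) * b x ^ k x \<in> J [^]\<^bsub>ideals_set ring_of_type_algebra\<^esub> ((\<Sum>x\<in>A. k x) + k x)"
    by (rule power_mem_ideal_pow[OF J]) (use insert in auto)
  thus ?case using insert by (simp add: add.commute mult.commute)
qed

lemma ideal_pow_antimono:
  fixes J :: "'a::comm_ring_1 set"
  assumes J: "ideal J ring_of_type_algebra" and "m \<le> n"
  shows "J [^]\<^bsub>ideals_set ring_of_type_algebra\<^esub> n \<subseteq> J [^]\<^bsub>ideals_set ring_of_type_algebra\<^esub> (m::nat)"
  using \<open>m \<le> n\<close>
proof (induction rule: dec_induct)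
  case (step n)
  interpret cring "ring_of_type_algebra :: 'a ring" by (rule cring_from_type_algebra)
  have "J [^]\<^bsub>ideals_set ring_of_type_algebra\<^esub> Suc n \<subseteq> J [^]\<^bsub>ideals_set ring_of_type_algebra\<^esub> n"
    using ideal_prod_inter[OF ideal_pow[OF J, of n] J] unfolding ideal_pow_simps by blast
  with step show ?case by blast
qed simp

section \<open>Spans of monomials\<close>

text \<open>The span of the monomials with exponents in \<open>S\<close>, described through
  supports, so that membership questions become questions about exponents.\<close>

definition mono_span :: "'a set \<Rightarrow> ('a \<Rightarrow>\<^sub>0 'k::zero) set" where
  "mono_span S = {p. Poly_Mapping.keys p \<subseteq> S}"

lemma mem_mono_span_iff: "p \<in> mono_span S \<longleftrightarrow> (\<forall>a\<in>Poly_Mapping.keys p. a \<in> S)"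
  by (auto simp: mono_span_def)

definition monomial :: "'a \<Rightarrow> 'a \<Rightarrow>\<^sub>0 'k::comm_ring_1" where
  "monomial a = Poly_Mapping.single a 1"

lemma monomial_add: "monomial (a + b) = monomial a * monomial b"
  by (simp add: monomial_def mult_single)

lemma monomial_sum: "finite A \<Longrightarrow> monomial (\<Sum>x\<in>A. f x) = (\<Prod>x\<in>A. monomial (f x))"
  by (induction A rule: finite_induct) (simp_all add: monomial_add, simp add: monomial_def)

lemma keys_monomial [simp]: "Poly_Mapping.keys (monomial a :: 'a \<Rightarrow>\<^sub>0 'k::comm_ring_1) = {a}"
  by (simp add: monomial_def)

lemma sum_single_lookup:
  "(\<Sum>a\<in>Poly_Mapping.keys p. Poly_Mapping.single a (Poly_Mapping.lookup p a)) = p"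
proof (rule poly_mapping_eqI)
  fix b
  have "Poly_Mapping.lookup (\<Sum>a\<in>Poly_Mapping.keys p. Poly_Mapping.single a (Poly_Mapping.lookup p a)) b
     = (\<Sum>a\<in>Poly_Mapping.keys p. if a = b then Poly_Mapping.lookup p a else 0)"
    unfolding lookup_sum by (rule sum.cong) (auto simp: lookup_single)
  also have "\<dots> = Poly_Mapping.lookup p b"
    by (simp add: in_keys_iff)
  finally show "Poly_Mapping.lookup (\<Sum>a\<in>Poly_Mapping.keys p. Poly_Mapping.single a (Poly_Mapping.lookup p a)) b
    = Poly_Mapping.lookup p b" .
qed

lemma mono_span_subset_ideal:
  fixes J :: "('a::comm_monoid_add \<Rightarrow>\<^sub>0 'k::comm_ring_1) set"
  assumes J: "ideal J ring_of_type_algebra" and S: "\<And>a. a \<in> S \<Longrightarrow> monomial a \<in> J"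
  shows "mono_span S \<subseteq> J"
proof
  have J0: "0 \<in> J" and Jadd: "\<And>a b. a \<in> J \<Longrightarrow> b \<in> J \<Longrightarrow> a + b \<in> J"
    and Jmult: "\<And>a r. a \<in> J \<Longrightarrow> r * a \<in> J"
    using J by (auto simp: ideal_ring_of_type_algebra_iff)
  have sumJ: "finite A \<Longrightarrow> (\<And>a. a \<in> A \<Longrightarrow> f a \<in> J) \<Longrightarrow> sum f A \<in> J" for f and A :: "'a set"
    by (induction A rule: finite_induct) (auto simp: J0 Jadd)
  fix p :: "'a \<Rightarrow>\<^sub>0 'k" assume p: "p \<in> mono_span S"
  have "(\<Sum>a\<in>Poly_Mapping.keys p. Poly_Mapping.single a (Poly_Mapping.lookup p a)) \<in> J"
  proof (rule sumJ)
    fix a assume "a \<in> Poly_Mapping.keys p"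
    \<comment> \<open>A term is its coefficient, viewed as a constant polynomial, times a
      monomial.\<close>
    hence "Poly_Mapping.single 0 (Poly_Mapping.lookup p a) * monomial a \<in> J"
      using p S Jmult by (auto simp: mono_span_def)
    thus "Poly_Mapping.single a (Poly_Mapping.lookup p a) \<in> J"
      by (simp add: monomial_def mult_single)
  qed simp
  thus "p \<in> J" by (simp add: sum_single_lookup)
qed

lemma ideal_mono_span:
  fixes S :: "'a::comm_monoid_add set"
  assumes "\<And>a b. a \<in> S \<Longrightarrow> b + a \<in> S"
  shows "ideal (mono_span S :: ('a \<Rightarrow>\<^sub>0 'k::comm_ring_1) set) ring_of_type_algebra"
  unfolding ideal_ring_of_type_algebra_iff
proof (intro conjI ballI allI)
  show "(0 :: 'a \<Rightarrow>\<^sub>0 'k) \<in> mono_span S" by (simp add: mono_span_def)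
next
  fix p q :: "'a \<Rightarrow>\<^sub>0 'k" assume "p \<in> mono_span S" "q \<in> mono_span S"
  thus "p + q \<in> mono_span S" using Poly_Mapping.keys_add[of p q] by (auto simp: mono_span_def)
next
  fix p q :: "'a \<Rightarrow>\<^sub>0 'k" assume "p \<in> mono_span S"
  thus "q * p \<in> mono_span S" using keys_mult[of q p] assms by (fastforce simp: mono_span_def)
qed

text \<open>The exponent vector of the squarefree monomial with support \<open>A\<close>.\<close>

definition indicator_exp :: "'v::finite set \<Rightarrow> 'v \<Rightarrow>\<^sub>0 nat" where
  "indicator_exp A = (\<Sum>x\<in>A. Poly_Mapping.single x 1)"

lemma lookup_indicator_exp [simp]: "Poly_Mapping.lookup (indicator_exp A) x = of_bool (x \<in> A)"
  by (simp add: indicator_exp_def lookup_sum lookup_single when_def)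

lemma keys_indicator_exp [simp]: "Poly_Mapping.keys (indicator_exp A) = A"
  by (auto simp: in_keys_iff)

lemma prod_var_eq_monomial: "(\<Prod>x\<in>A. var x) = monomial (indicator_exp A)"
  by (simp add: indicator_exp_def monomial_sum var_def) (simp add: monomial_def)

text \<open>A generator divides a monomial exactly when its edge lies in the support of the
  exponent, and the exponents with this property are closed under addition of arbitrary
  exponents.\<close>

lemma edge_ideal_eq_mono_span:
  fixes E :: "'v::finite set set"
  shows "(edge_ideal E :: ('v, 'k::comm_ring_1) mpoly set) =
    mono_span {a. \<exists>e\<in>E. e \<subseteq> Poly_Mapping.keys a}" (is "?I = mono_span ?S")
proof
  interpret cring "ring_of_type_algebra :: ('v, 'k) mpoly ring"
    by (rule cring_from_type_algebra)
  have Skeys: "b + a \<in> ?S" if "a \<in> ?S" for a b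
  proof -
    have "Poly_Mapping.keys a \<subseteq> Poly_Mapping.keys (b + a)"
      by (auto simp: in_keys_iff lookup_add)
    thus ?thesis using that by blast
  qed
  show "?I \<subseteq> mono_span ?S"
    unfolding edge_ideal_def
  proof (rule genideal_minimal)
    show "ideal (mono_span ?S :: ('v, 'k) mpoly set) ring_of_type_algebra"
      by (rule ideal_mono_span) (rule Skeys)
  qed (auto simp: prod_var_eq_monomial mono_span_def)
  have "ideal ?I ring_of_type_algebra"
    unfolding edge_ideal_def by (rule genideal_ideal) simp
  thus "mono_span ?S \<subseteq> ?I"
  proof (rule mono_span_subset_ideal)
    fix a assume "a \<in> ?S"
    then obtain e where e: "e \<in> E" "e \<subseteq> Poly_Mapping.keys a" by blast
    \<comment> \<open>The truncated subtraction is exact, because \<open>a\<close> is positive on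
      \<open>e\<close>.\<close>
    have "a = (a - indicator_exp e) + indicator_exp e"
      using e(2) by (intro poly_mapping_eqI) (auto simp: lookup_add lookup_minus in_keys_iff)
    hence "monomial a = monomial (a - indicator_exp e) * (monomial (indicator_exp e) :: ('v, 'k) mpoly)"
      by (metis monomial_add)
    moreover have "monomial (indicator_exp e) \<in> ?I"
      unfolding edge_ideal_def by (rule subsetD[OF genideal_self]) (use e(1) in \<open>auto simp: prod_var_eq_monomial\<close>)
    ultimately show "monomial a \<in> ?I"
      using \<open>ideal ?I ring_of_type_algebra\<close> by (auto simp: ideal_ring_of_type_algebra_iff)
  qed
qed

lemma ideal_edge_ideal: "ideal (edge_ideal E) ring_of_type_algebra"
  unfolding edge_ideal_def
  by (intro ring.genideal_ideal cring.axioms(1) cring_from_type_algebra) simp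

text \<open>The polynomials all of whose exponents have weight at least 1 on \<open>C\<close> form
  the prime ideal \<open>P_C\<close> generated by the variables in \<open>C\<close>; weight at least
  \<open>m\<close> describes the \<open>m\<close>-th power of \<open>P_C\<close>.\<close>

definition weight :: "'v::finite set \<Rightarrow> ('v \<Rightarrow>\<^sub>0 nat) \<Rightarrow> nat" where
  "weight C a = (\<Sum>x\<in>C. Poly_Mapping.lookup a x)"

lemma weight_add: "weight C (a + b) = weight C a + weight C b"
  by (simp add: weight_def lookup_add sum.distrib)

lemma ideal_weight_ge: "ideal (mono_span {a. m \<le> weight C a} :: ('v::finite, 'k::comm_ring_1) mpoly set) ring_of_type_algebra"
  by (rule ideal_mono_span) (simp add: weight_add)

section \<open>Cancelling factors outside \<open>P_C\<close>\<close>

lemma split_poly_mapping: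
  fixes p :: "'a \<Rightarrow>\<^sub>0 'k::comm_monoid_add"
  obtains q r where "p = q + r" "Poly_Mapping.keys q = Poly_Mapping.keys p \<inter> S" "Poly_Mapping.keys r = Poly_Mapping.keys p - S"
proof
  define q where "q = Poly_Mapping.mapp (\<lambda>a c. c when a \<in> S) p"
  define r where "r = Poly_Mapping.mapp (\<lambda>a c. c when a \<notin> S) p"
  show "p = q + r"
    by (rule poly_mapping_eqI) (auto simp: q_def r_def lookup_add lookup_mapp when_def in_keys_iff)
  show "Poly_Mapping.keys q = Poly_Mapping.keys p \<inter> S" "Poly_Mapping.keys r = Poly_Mapping.keys p - S"
    by (auto simp: q_def r_def lookup_mapp when_def in_keys_iff split: if_splits)
qed

text \<open>In a product, the lowest weight parts of the factors multiply to a nonzero polynomial.\<close>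

lemma weight_ge_cancel:
  fixes s p :: "('v::{finite,linorder}, 'k::idom) mpoly"
  assumes s: "s \<notin> mono_span {a. 1 \<le> weight C a}" and sp: "s * p \<in> mono_span {a. m \<le> weight C a}"
  shows "p \<in> mono_span {a. m \<le> weight C a}"
proof (rule ccontr)
  assume "p \<notin> mono_span {a. m \<le> weight C a}"
  then obtain a0 where a0: "a0 \<in> Poly_Mapping.keys p" "weight C a0 < m"
    by (auto simp: mono_span_def subset_iff not_le)
  define d where "d = Min (weight C ` Poly_Mapping.keys p)"
  have "d \<in> weight C ` Poly_Mapping.keys p"
    unfolding d_def using a0 by (intro Min_in) auto
  then obtain a1 where a1: "a1 \<in> Poly_Mapping.keys p" "weight C a1 = d" by blast
  have d_le: "d \<le> weight C a" if "a \<in> Poly_Mapping.keys p" for a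
    unfolding d_def using that by (intro Min_le) auto
  \<comment> \<open>\<open>p0\<close> is the part of \<open>p\<close> of lowest weight
    \<open>d\<close>, and \<open>s0\<close> is the part of \<open>s\<close> of weight 0, which is
    nonzero because \<open>s\<close> lies outside \<open>P_C\<close>.\<close>
  obtain p0 p1 where p: "p = p0 + p1"
    "Poly_Mapping.keys p0 = Poly_Mapping.keys p \<inter> {a. weight C a = d}"
    "Poly_Mapping.keys p1 = Poly_Mapping.keys p - {a. weight C a = d}"
    by (rule split_poly_mapping)
  obtain s0 s1 where s': "s = s0 + s1"
    "Poly_Mapping.keys s0 = Poly_Mapping.keys s \<inter> {a. weight C a = 0}"
    "Poly_Mapping.keys s1 = Poly_Mapping.keys s - {a. weight C a = 0}"
    by (rule split_poly_mapping)
  have "Poly_Mapping.keys s0 \<noteq> {}"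
    using s s'(2) by (auto simp: mono_span_def subset_iff not_le)
  hence "s0 \<noteq> 0" by auto
  moreover have "p0 \<noteq> 0" using a1 p(2) by auto
  ultimately have "s0 * p0 \<noteq> 0" by simp
  then obtain c where c: "c \<in> Poly_Mapping.keys (s0 * p0)"
    by (metis all_not_in_conv keys_eq_empty)
  hence wc: "weight C c = d"
    using keys_mult[of s0 p0] s'(2) p(2) by (auto simp: weight_add)
  \<comment> \<open>Everything in \<open>s * p\<close> apart from \<open>s0 * p0\<close> has weight
    above \<open>d\<close>, so the term at \<open>c\<close> cannot be cancelled.\<close>
  let ?D = "mono_span {a. d + 1 \<le> weight C a} :: ('v, 'k) mpoly set"
  have D: "0 \<in> ?D" "\<And>a b. a \<in> ?D \<Longrightarrow> b \<in> ?D \<Longrightarrow> a + b \<in> ?D" "\<And>a r. a \<in> ?D \<Longrightarrow> r * a \<in> ?D"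
    using ideal_weight_ge[of "d + 1" C, where 'k = 'k]
    unfolding ideal_ring_of_type_algebra_iff by blast+
  have "p1 \<in> ?D" using p(3) d_le by (fastforce simp: mono_span_def)
  moreover have "s1 * p0 \<in> ?D"
    using keys_mult[of s1 p0] s'(3) p(2) by (fastforce simp: mono_span_def weight_add)
  moreover have "s * p = s0 * p0 + (s1 * p0 + s * p1)"
    unfolding s'(1) p(1) by (simp add: algebra_simps)
  ultimately obtain r where r: "s * p = s0 * p0 + r" "r \<in> ?D" using D by blast
  have "c \<notin> Poly_Mapping.keys r" using r(2) wc by (auto simp: mono_span_def)
  hence "c \<in> Poly_Mapping.keys (s * p)"
    using c by (simp add: r(1) in_keys_iff lookup_add)
  hence "m \<le> d" using sp wc by (auto simp: mono_span_def)
  moreover have "d \<le> weight C a0" using a0 d_le by blast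
  ultimately show False using a0(2) by simp
qed

section \<open>Symbolic powers of edge ideals\<close>

definition vertex_cover :: "'v set set \<Rightarrow> 'v set \<Rightarrow> bool" where
  "vertex_cover E C \<longleftrightarrow> (\<forall>e\<in>E. e \<inter> C \<noteq> {})"

text \<open>Take an inclusion-minimal cover inside \<open>C\<close>. Removing a vertex
  \<open>x\<close> from it uncovers some edge, and that edge meets the cover only in
  \<open>x\<close>. Such private edges are the form in which minimality is used.\<close>

lemma vertex_cover_minimal:
  fixes E :: "'v::finite set set"
  assumes "vertex_cover E C"
  obtains D where "D \<subseteq> C" "vertex_cover E D" "\<forall>x\<in>D. \<exists>e\<in>E. e \<inter> D = {x}"
proof -
  define S where "S = {D. D \<subseteq> C \<and> vertex_cover E D}"
  have "C \<in> S" using assms by (simp add: S_def)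
  hence "S \<noteq> {}" by blast
  from finite_has_minimal[OF finite this]
  obtain D where "D \<in> S" and min: "\<forall>D'\<in>S. D' \<subseteq> D \<longrightarrow> D = D'" ..
  hence D: "D \<subseteq> C" "vertex_cover E D" by (simp_all add: S_def)
  have "\<exists>e\<in>E. e \<inter> D = {x}" if x: "x \<in> D" for x
  proof -
    have "D - {x} \<notin> S"
    proof
      assume "D - {x} \<in> S"
      hence "D = D - {x}" using min by simp
      thus False using x by blast
    qed
    hence "\<not> vertex_cover E (D - {x})" using D(1) unfolding S_def by blast
    then obtain e where "e \<in> E" "e \<inter> (D - {x}) = {}" by (auto simp: vertex_cover_def)
    moreover from this have "e \<inter> D \<noteq> {}" using D(2) by (auto simp: vertex_cover_def)
    ultimately have "e \<inter> D = {x}" by blast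
    thus ?thesis using \<open>e \<in> E\<close> by blast
  qed
  thus thesis by (intro that[OF D] ballI)
qed

lemma weight_pos_iff: "1 \<le> weight C a \<longleftrightarrow> Poly_Mapping.keys a \<inter> C \<noteq> {}"
proof -
  have "weight C a = 0 \<longleftrightarrow> Poly_Mapping.keys a \<inter> C = {}"
    by (auto simp: weight_def in_keys_iff)
  thus ?thesis by linarith
qed

text \<open>Translation of exponents by \<open>b\<close> is injective, so no two terms of the
  product merge.\<close>

lemma keys_mult_monomial:
  fixes p :: "'a::cancel_comm_monoid_add \<Rightarrow>\<^sub>0 'k::comm_ring_1"
  shows "Poly_Mapping.keys (p * monomial b) = (\<lambda>a. a + b) ` Poly_Mapping.keys p"
proof
  show "Poly_Mapping.keys (p * monomial b) \<subseteq> (\<lambda>a. a + b) ` Poly_Mapping.keys p"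
    using keys_mult[of p "monomial b"] by auto
  have "Poly_Mapping.lookup (p * monomial b) (a + b) = Poly_Mapping.lookup p a" for a
  proof -
    have "p * monomial b = (\<Sum>c\<in>Poly_Mapping.keys p. Poly_Mapping.single (c + b) (Poly_Mapping.lookup p c))"
      by (subst sum_single_lookup[of p, symmetric])
        (simp add: sum_distrib_right monomial_def mult_single del: sum_single_lookup)
    also have "Poly_Mapping.lookup \<dots> (a + b) = (\<Sum>c\<in>Poly_Mapping.keys p. if c = a then Poly_Mapping.lookup p c else 0)"
      unfolding lookup_sum by (rule sum.cong) (auto simp: lookup_single when_def)
    also have "\<dots> = Poly_Mapping.lookup p a" by (simp add: in_keys_iff)
    finally show ?thesis .
  qed
  thus "(\<lambda>a. a + b) ` Poly_Mapping.keys p \<subseteq> Poly_Mapping.keys (p * monomial b)"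
    by (auto simp: in_keys_iff)
qed

lemma keys_add_nat:
  fixes a b :: "'v \<Rightarrow>\<^sub>0 nat"
  shows "Poly_Mapping.keys (a + b) = Poly_Mapping.keys a \<union> Poly_Mapping.keys b"
  by (auto simp: in_keys_iff lookup_add)

text \<open>\<open>P_C\<close> consists of the multipliers that carry the squarefree monomial on the
  complement of \<open>C\<close> into the edge ideal. If the support of \<open>a\<close> contains
  some \<open>x\<close> in \<open>C\<close>, the private edge of \<open>x\<close> lies in that
  support together with \<open>- C\<close>; conversely, an edge lying there meets the cover
  \<open>C\<close>, hence meets the support inside \<open>C\<close>.\<close>

lemma minimal_cover_associated_prime:
  fixes E :: "'v::{finite,linorder} set set"
  assumes C: "vertex_cover E C" "\<forall>x\<in>C. \<exists>e\<in>E. e \<inter> C = {x}"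
  shows "(mono_span {a. 1 \<le> weight C a} :: ('v, 'k::idom) mpoly set)
    \<in> associated_primes ring_of_type_algebra (edge_ideal E)" (is "?P \<in> _")
proof -
  have "primeideal ?P ring_of_type_algebra"
  proof (rule primeidealI)
    show "ideal ?P ring_of_type_algebra" by (rule ideal_weight_ge)
    show "cring (ring_of_type_algebra :: ('v, 'k) mpoly ring)" by (rule cring_from_type_algebra)
    have "1 \<notin> ?P" by (simp add: mono_span_def weight_def)
    thus "carrier ring_of_type_algebra \<noteq> ?P" by (simp, blast)
    fix a b :: "('v, 'k) mpoly" assume "a \<otimes>\<^bsub>ring_of_type_algebra\<^esub> b \<in> ?P"
    hence "a * b \<in> ?P" by simp
    \<comment> \<open>Primality is weight cancellation for \<open>m = 1\<close>.\<close>
    thus "a \<in> ?P \<or> b \<in> ?P" using weight_ge_cancel[of a C b 1] by (cases "a \<in> ?P") simp_all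
  qed
  moreover have "r \<in> ?P \<longleftrightarrow> r * monomial (indicator_exp (- C)) \<in> edge_ideal E" for r :: "('v, 'k) mpoly"
  proof -
    have "Poly_Mapping.keys a \<inter> C \<noteq> {} \<longleftrightarrow> (\<exists>e\<in>E. e \<subseteq> Poly_Mapping.keys a \<union> - C)" for a :: "'v \<Rightarrow>\<^sub>0 nat"
    proof
      assume "Poly_Mapping.keys a \<inter> C \<noteq> {}"
      then obtain x where x: "x \<in> Poly_Mapping.keys a" "x \<in> C" by blast
      obtain e where e: "e \<in> E" "e \<inter> C = {x}" using bspec[OF C(2) x(2)] ..
      have "e \<subseteq> Poly_Mapping.keys a \<union> - C"
      proof
        fix y assume "y \<in> e"
        show "y \<in> Poly_Mapping.keys a \<union> - C"
        proof (cases "y \<in> C")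
          case True
          hence "y \<in> {x}" using \<open>y \<in> e\<close> unfolding e(2)[symmetric] by simp
          thus ?thesis using x(1) by simp
        qed simp
      qed
      thus "\<exists>e\<in>E. e \<subseteq> Poly_Mapping.keys a \<union> - C" using e(1) ..
    next
      assume "\<exists>e\<in>E. e \<subseteq> Poly_Mapping.keys a \<union> - C"
      then obtain e where e: "e \<in> E" "e \<subseteq> Poly_Mapping.keys a \<union> - C" by blast
      then obtain x where "x \<in> e" "x \<in> C" using C(1) by (auto simp: vertex_cover_def)
      with e(2) have "x \<in> Poly_Mapping.keys a \<inter> C" by auto
      thus "Poly_Mapping.keys a \<inter> C \<noteq> {}" by blast
    qed
    note cover = this
    have "r \<in> ?P \<longleftrightarrow> (\<forall>a\<in>Poly_Mapping.keys r. Poly_Mapping.keys a \<inter> C \<noteq> {})"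
      unfolding mono_span_def weight_pos_iff subset_iff mem_Collect_eq by (simp only: Ball_def)
    also have "\<dots> \<longleftrightarrow> r * monomial (indicator_exp (- C)) \<in> edge_ideal E"
      unfolding edge_ideal_eq_mono_span mono_span_def keys_mult_monomial cover mem_Collect_eq
        image_subset_iff keys_add_nat keys_indicator_exp ..
    finally show ?thesis .
  qed
  hence "?P = {r\<in>carrier ring_of_type_algebra. r \<otimes>\<^bsub>ring_of_type_algebra\<^esub> monomial (indicator_exp (- C)) \<in> edge_ideal E}"
    by (simp add: set_eq_iff)
  moreover have "monomial (indicator_exp (- C)) \<in> carrier (ring_of_type_algebra :: ('v, 'k) mpoly ring)"
    by simp
  ultimately show ?thesis
    unfolding associated_primes_def mem_Collect_eq by (intro conjI bexI)
qed

text \<open>Each edge meets \<open>C\<close>, so every exponent in the edge ideal has weight at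
  least 1 on \<open>C\<close>, and weights add under multiplication.\<close>

lemma ideal_pow_edge_ideal_subset:
  fixes E :: "'v::finite set set"
  assumes "vertex_cover E C"
  shows "(edge_ideal E :: ('v, 'k::comm_ring_1) mpoly set) [^]\<^bsub>ideals_set ring_of_type_algebra\<^esub> (m::nat)
    \<subseteq> mono_span {a. m \<le> weight C a}"
proof (induction m)
  case 0
  show ?case by (simp add: mono_span_def)
next
  case (Suc m)
  show ?case unfolding ideal_pow_simps
  proof
    fix p :: "('v, 'k) mpoly"
    assume "p \<in> ideal_prod ring_of_type_algebra
      ((edge_ideal E) [^]\<^bsub>ideals_set ring_of_type_algebra\<^esub> m) (edge_ideal E)"
    thus "p \<in> mono_span {a. Suc m \<le> weight C a}"
    proof induction
      case (prod i j)
      have i: "m \<le> weight C a" if "a \<in> Poly_Mapping.keys i" for a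
        using subsetD[OF Suc prod(1)] that by (auto simp: mono_span_def)
      have j: "1 \<le> weight C a" if a: "a \<in> Poly_Mapping.keys j" for a
      proof -
        obtain e where "e \<in> E" "e \<subseteq> Poly_Mapping.keys a"
          using prod(2) a by (auto simp: edge_ideal_eq_mono_span mem_mono_span_iff)
        with assms show ?thesis unfolding weight_pos_iff vertex_cover_def by blast
      qed
      have "Suc m \<le> weight C c" if c: "c \<in> Poly_Mapping.keys (i * j)" for c
      proof -
        obtain a b where "c = a + b" "a \<in> Poly_Mapping.keys i" "b \<in> Poly_Mapping.keys j"
          using keys_mult[of i j] c by blast
        with i[of a] j[of b] show ?thesis by (simp add: weight_add)
      qed
      thus ?case by (auto simp: mono_span_def)
    next
      case (sum s1 s2)
      thus ?case using ideal_weight_ge[of "Suc m" C, where 'k = 'k]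
        by (auto simp: ideal_ring_of_type_algebra_iff)
    qed
  qed
qed

section \<open>Exponents and monomials of symbolic powers\<close>

lemma primeideal_ring_of_type_algebraD:
  fixes P :: "'a::comm_ring_1 set"
  assumes "primeideal P ring_of_type_algebra"
  shows "0 \<in> P" "1 \<notin> P" "s \<notin> P \<Longrightarrow> t \<notin> P \<Longrightarrow> s * t \<notin> P"
proof -
  interpret P: primeideal P "ring_of_type_algebra :: 'a ring" by fact
  have mult: "r * a \<in> P" if "a \<in> P" for a r
    using P.is_ideal that unfolding ideal_ring_of_type_algebra_iff by simp
  show "0 \<in> P" using P.is_ideal unfolding ideal_ring_of_type_algebra_iff by simp
  show "1 \<notin> P"
  proof
    assume "1 \<in> P"
    hence "r \<in> P" for r using mult[of 1 r] by simp
    hence "P = UNIV" by (simp add: set_eq_iff)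
    thus False using P.I_notcarr by simp
  qed
  show "s \<notin> P \<Longrightarrow> t \<notin> P \<Longrightarrow> s * t \<notin> P" using P.I_prime[of s t] by auto
qed

text \<open>Pass to a minimal cover \<open>D\<close> inside \<open>C\<close> and localize at its
  prime: some \<open>s\<close> outside the prime carries \<open>p\<close> into the
  \<open>m\<close>-th power of the edge ideal, where weights on \<open>D\<close> are at least
  \<open>m\<close>, and \<open>s\<close> can be cancelled. Enlarging \<open>D\<close> to
  \<open>C\<close> only increases the weight.\<close>

lemma symbolic_power_weight:
  fixes E :: "'v::{finite,linorder} set set" and p :: "('v, 'k::idom) mpoly"
  assumes p: "p \<in> symbolic_power (edge_ideal E) m" and a: "a \<in> Poly_Mapping.keys p"
    and C: "vertex_cover E C"
  shows "m \<le> weight C a"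
proof -
  obtain D where D: "D \<subseteq> C" "vertex_cover E D" "\<forall>x\<in>D. \<exists>e\<in>E. e \<inter> D = {x}"
    using vertex_cover_minimal[OF C] .
  let ?P = "mono_span {a. 1 \<le> weight D a} :: ('v, 'k) mpoly set"
  have P: "?P \<in> associated_primes ring_of_type_algebra (edge_ideal E)"
    using D by (intro minimal_cover_associated_prime)
  hence prime: "primeideal ?P ring_of_type_algebra" by (simp add: associated_primes_def)
  have "p \<in> extend_contract ?P (edge_ideal E [^]\<^bsub>ideals_set ring_of_type_algebra\<^esub> m)"
    using p P unfolding symbolic_power_def by blast
  then obtain s where s: "s \<notin> ?P" "s * p \<in> edge_ideal E [^]\<^bsub>ideals_set ring_of_type_algebra\<^esub> m"
    using extend_contract_iff[OF primeideal_ring_of_type_algebraD(1-3)[OF prime] ideal_pow[OF ideal_edge_ideal]] by blast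
  have "s * p \<in> mono_span {a. m \<le> weight D a}"
    using s(2) ideal_pow_edge_ideal_subset[OF D(2)] by blast
  hence "p \<in> mono_span {a. m \<le> weight D a}" using s(1) by (rule weight_ge_cancel[rotated])
  hence "m \<le> weight D a" using a by (auto simp: mono_span_def)
  also have "weight D a \<le> weight C a"
    unfolding weight_def using D(1) by (intro sum_mono2) auto
  finally show ?thesis .
qed

text \<open>Hence every variable in \<open>P\<close> belongs to the localization of \<open>I\<close> at \<open>P\<close>.\<close>

lemma associated_prime_private_edge:
  fixes E :: "'v::{finite,linorder} set set"
  assumes P: "P \<in> associated_primes ring_of_type_algebra (edge_ideal E :: ('v, 'k::idom) mpoly set)"
    and x: "var x \<in> P"
  shows "\<exists>e\<in>E. x \<in> e \<and> (\<forall>y\<in>e. var y \<in> P \<longrightarrow> y = x)"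
proof -
  obtain f where f: "P = {r. r * f \<in> edge_ideal E}" and prime: "primeideal P ring_of_type_algebra"
    using P by (auto simp: associated_primes_def)
  have "f \<notin> edge_ideal E" using primeideal_ring_of_type_algebraD(2)[OF prime] f by auto
  \<comment> \<open>The edge ideal is spanned by monomials, so some term of \<open>f\<close> lies
    outside it. If \<open>var y\<close> is in \<open>P\<close>, then \<open>var y\<close> carries
    this term into the ideal, so the support of \<open>b\<close> together with \<open>y\<close>
    contains an edge.\<close>
  then obtain b where b: "b \<in> Poly_Mapping.keys f" "\<not> (\<exists>e\<in>E. e \<subseteq> Poly_Mapping.keys b)"
    by (auto simp: edge_ideal_eq_mono_span mem_mono_span_iff)
  have var_P: "\<exists>e\<in>E. e \<subseteq> insert y (Poly_Mapping.keys b)" if "var y \<in> P" for y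
  proof -
    have "f * monomial (Poly_Mapping.single y 1) \<in> edge_ideal E"
      using that by (simp add: f var_def monomial_def mult.commute)
    hence "b + Poly_Mapping.single y 1 \<in> {a. \<exists>e\<in>E. e \<subseteq> Poly_Mapping.keys a}"
      using b(1) by (simp add: edge_ideal_eq_mono_span mem_mono_span_iff keys_mult_monomial)
    thus ?thesis by (simp add: keys_add_nat)
  qed
  obtain e where e: "e \<in> E" "e \<subseteq> insert x (Poly_Mapping.keys b)" using var_P[OF x] by blast
  have "y = x" if "y \<in> e" "var y \<in> P" for y
  proof (rule ccontr)
    assume "y \<noteq> x"
    \<comment> \<open>Since \<open>y\<close> is in \<open>e\<close> and differs from
      \<open>x\<close>, it already lies in the support of \<open>b\<close>, which would then contain
      an edge.\<close>
    hence "insert y (Poly_Mapping.keys b) = Poly_Mapping.keys b" using e that by blast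
    thus False using var_P[OF that(2)] b(2) by simp
  qed
  moreover have "x \<in> e" using e b(2) by blast
  ultimately show ?thesis using e(1) by blast
qed

lemma prod_notin_prime:
  fixes P :: "'a::comm_ring_1 set"
  assumes "primeideal P ring_of_type_algebra" "\<And>x. x \<in> A \<Longrightarrow> f x \<notin> P"
  shows "prod f A \<notin> P"
  using assms(2)
  by (induction A rule: infinite_finite_induct) (auto simp: primeideal_ring_of_type_algebraD[OF assms(1)])

lemma power_notin_prime:
  fixes P :: "'a::comm_ring_1 set"
  assumes "primeideal P ring_of_type_algebra" "s \<notin> P"
  shows "s ^ n \<notin> P"
  by (induction n) (auto simp: primeideal_ring_of_type_algebraD[OF assms(1)] assms(2))

lemma monomial_eq_prod_var:
  fixes a :: "'v::finite \<Rightarrow>\<^sub>0 nat"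
  shows "monomial a = (\<Prod>x\<in>UNIV. var x ^ Poly_Mapping.lookup a x)"
proof -
  have pow: "var x ^ n = monomial (Poly_Mapping.single x n)" for x :: 'v and n
    by (induction n) (simp_all add: var_def monomial_def mult_single flip: single_add)
  have "a = (\<Sum>x\<in>UNIV. Poly_Mapping.single x (Poly_Mapping.lookup a x))"
    by (rule poly_mapping_eqI) (simp add: lookup_sum lookup_single when_def)
  hence "monomial a = monomial (\<Sum>x\<in>UNIV. Poly_Mapping.single x (Poly_Mapping.lookup a x))"
    by (rule arg_cong)
  also have "\<dots> = (\<Prod>x\<in>UNIV. monomial (Poly_Mapping.single x (Poly_Mapping.lookup a x)))"
    by (rule monomial_sum) simp
  finally show ?thesis by (simp only: pow)
qed

text \<open>At an associated prime \<open>P\<close>, let \<open>C\<close> be the set of variables in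
  \<open>P\<close>. The other variables of a private edge of \<open>x\<close> multiply to some
  \<open>s x\<close> outside \<open>P\<close> with \<open>s x * var x\<close> in the edge ideal.
  Multiplying \<open>monomial a\<close> by the product of the powers \<open>s x ^ k x\<close>
  therefore yields an element of the power of the ideal whose exponent is the weight of
  \<open>a\<close> on \<open>C\<close>, which is at least \<open>m\<close> because \<open>C\<close>
  is a vertex cover.\<close>

lemma monomial_in_symbolic_power:
  fixes E :: "'v::{finite,linorder} set set"
  assumes a: "\<And>C. vertex_cover E C \<Longrightarrow> m \<le> weight C a"
  shows "(monomial a :: ('v, 'k::idom) mpoly) \<in> symbolic_power (edge_ideal E) m"
  unfolding symbolic_power_def
proof (rule INT_I)
  let ?I = "edge_ideal E :: ('v, 'k) mpoly set"
  fix P assume P: "P \<in> associated_primes ring_of_type_algebra ?I"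
  hence prime: "primeideal P ring_of_type_algebra" by (simp add: associated_primes_def)
  have idl: "ideal ?I ring_of_type_algebra" by (rule ideal_edge_ideal)
  define C where "C = {x. (var x :: ('v, 'k) mpoly) \<in> P}"
  define k where "k = Poly_Mapping.lookup a"
  have "\<forall>x\<in>C. \<exists>e\<in>E. x \<in> e \<and> e \<inter> C = {x}"
  proof
    fix x assume "x \<in> C"
    hence "var x \<in> P" by (simp add: C_def)
    from associated_prime_private_edge[OF P this] obtain e
      where e: "e \<in> E" "x \<in> e" "\<forall>y\<in>e. var y \<in> P \<longrightarrow> y = x" by metis
    have "e \<inter> C = {x}"
    proof (intro subset_antisym subsetI)
      fix y assume "y \<in> e \<inter> C"
      hence "y \<in> e" "var y \<in> P" by (simp_all add: C_def)
      thus "y \<in> {x}" using e(3) by simp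
    qed (use \<open>x \<in> C\<close> e(2) in simp)
    thus "\<exists>e\<in>E. x \<in> e \<and> e \<inter> C = {x}" using e(1,2) by metis
  qed
  then obtain e where e: "\<And>x. x \<in> C \<Longrightarrow> e x \<in> E \<and> x \<in> e x \<and> e x \<inter> C = {x}" by metis
  define s where "s x = (\<Prod>y\<in>e x - {x}. var y :: ('v, 'k) mpoly)" for x
  have prod_I: "(\<Prod>y\<in>e'. var y) \<in> ?I" if "e' \<in> E" for e'
    using that by (auto simp: prod_var_eq_monomial edge_ideal_eq_mono_span mono_span_def)
  have sI: "s x * var x \<in> ?I" if "x \<in> C" for x
  proof -
    have "s x * var x = (\<Prod>y\<in>e x. var y)"
      unfolding s_def using e[OF that] by (simp add: prod.remove[of "e x" x] mult.commute)
    thus ?thesis using prod_I e[OF that] by simp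
  qed
  have sP: "s x \<notin> P" if "x \<in> C" for x
    unfolding s_def using e[OF that] by (intro prod_notin_prime prime) (auto simp: C_def)
  \<comment> \<open>The edge ideal is contained in \<open>P\<close>, but an edge disjoint from
    \<open>C\<close> would give a product of variables outside the prime \<open>P\<close>.\<close>
  have "vertex_cover E C"
    unfolding vertex_cover_def
  proof (intro ballI notI)
    fix e' assume e': "e' \<in> E" "e' \<inter> C = {}"
    have "(\<Prod>y\<in>e'. var y) \<notin> P" using e' by (intro prod_notin_prime prime) (auto simp: C_def)
    moreover have "?I \<subseteq> P"
    proof
      fix p assume p: "p \<in> ?I"
      obtain f where f: "P = {r. r * f \<in> ?I}" using P by (auto simp: associated_primes_def)
      have "f * p \<in> ?I"
        using idl p unfolding ideal_ring_of_type_algebra_iff by simp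
      thus "p \<in> P" by (simp add: f mult.commute)
    qed
    ultimately show False using prod_I[OF e'(1)] by blast
  qed
  hence m: "m \<le> (\<Sum>x\<in>C. k x)" using a by (simp add: weight_def k_def)
  define t where "t = (\<Prod>x\<in>C. s x ^ k x)"
  have "t \<notin> P" unfolding t_def
    using sP by (intro prod_notin_prime power_notin_prime prime)
  moreover have "t * monomial a \<in> ?I [^]\<^bsub>ideals_set ring_of_type_algebra\<^esub> m"
  proof -
    have "(monomial a :: ('v, 'k) mpoly) = (\<Prod>x\<in>C. var x ^ k x) * (\<Prod>x\<in>- C. var x ^ k x)"
      unfolding monomial_eq_prod_var k_def
      by (subst prod.union_disjoint[symmetric]) (auto intro!: prod.cong)
    hence "t * monomial a = (\<Prod>x\<in>- C. var x ^ k x) * (\<Prod>x\<in>C. (s x * var x) ^ k x)"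
      by (simp add: t_def power_mult_distrib prod.distrib mult_ac)
    moreover have "(\<Prod>x\<in>C. (s x * var x) ^ k x) \<in> ?I [^]\<^bsub>ideals_set ring_of_type_algebra\<^esub> (\<Sum>x\<in>C. k x)"
      by (rule prod_power_mem_ideal_pow[OF ideal_edge_ideal]) (use sI in auto)
    hence "(\<Prod>x\<in>C. (s x * var x) ^ k x) \<in> ?I [^]\<^bsub>ideals_set ring_of_type_algebra\<^esub> m"
      using ideal_pow_antimono[OF ideal_edge_ideal m] by blast
    moreover have "ideal (?I [^]\<^bsub>ideals_set ring_of_type_algebra\<^esub> m) ring_of_type_algebra"
      by (rule ideal_pow[OF ideal_edge_ideal])
    ultimately show ?thesis by (simp add: ideal_ring_of_type_algebra_iff)
  qed
  ultimately show "monomial a \<in> extend_contract P (?I [^]\<^bsub>ideals_set ring_of_type_algebra\<^esub> m)"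
    using extend_contract_iff[OF primeideal_ring_of_type_algebraD(1-3)[OF prime] ideal_pow[OF ideal_edge_ideal]] by blast
qed

section \<open>Duality and the Waldschmidt constant\<close>

lemma continuous_on_Min:
  fixes f :: "'i \<Rightarrow> 'a::topological_space \<Rightarrow> 'b::linorder_topology"
  assumes "finite A" "A \<noteq> {}" "\<And>i. i \<in> A \<Longrightarrow> continuous_on S (f i)"
  shows "continuous_on S (\<lambda>x. Min ((\<lambda>i. f i x) ` A))"
  using assms
proof (induction A rule: finite_ne_induct)
  case (insert i A)
  have "continuous_on S (\<lambda>x. min (f i x) (Min ((\<lambda>i. f i x) ` A)))"
    using insert by (intro continuous_on_min) auto
  thus ?case using insert by simp
qed simp

text \<open>The minimax theorem for the game in which one player picks a vertex and the other a member of
  \<open>F\<close>, by separating the attainable vectors from those that exceed the value in all coordinates.\<close>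

lemma incidence_minimax:
  fixes F :: "'v::finite set set"
  assumes "F \<noteq> {}"
  obtains p :: "'v \<Rightarrow> real" and v :: real and y :: "'v set \<Rightarrow> real"
  where "\<And>x. 0 \<le> p x" "(\<Sum>x\<in>UNIV. p x) = 1" "\<And>W. W \<in> F \<Longrightarrow> (\<Sum>x\<in>W. p x) \<le> v"
    "\<And>W. W \<in> F \<Longrightarrow> 0 \<le> y W" "(\<Sum>W\<in>F. y W) = 1" "\<And>x. v \<le> (\<Sum>W\<in>F. incidence x W * y W)"
proof -
  \<comment> \<open>\<open>K\<close> is the set of coverage vectors of probability vectors on
    \<open>F\<close>, and \<open>f\<close> is the coverage of the worst covered vertex. The value
    \<open>v\<close> is the maximum of \<open>f\<close> on \<open>K\<close>.\<close>
  define iv :: "'v set \<Rightarrow> real^'v" where "iv W = (\<chi> x. incidence x W)" for W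
  define K where "K = convex hull (iv ` F)"
  define f where "f u = Min ((\<lambda>x. u $ x) ` UNIV)" for u :: "real^'v"
  have "compact K" unfolding K_def by (intro finite_imp_compact_convex_hull) simp
  moreover have "K \<noteq> {}" using assms by (simp add: K_def)
  moreover have "continuous_on K f"
    unfolding f_def by (intro continuous_on_Min continuous_intros) auto
  ultimately obtain u where u: "u \<in> K" and max: "\<And>w. w \<in> K \<Longrightarrow> f w \<le> f u"
    using continuous_attains_sup[of K f] by metis
  define v where "v = f u"
  have vu: "v \<le> u $ x" for x unfolding v_def f_def by (intro Min_le) auto
  \<comment> \<open>Convex coefficients are indexed by incidence vectors; injectivity transfers them
    to the sets themselves.\<close>
  have inj: "inj_on iv F"
  proof (rule inj_onI)
    fix A B assume "iv A = iv B"
    hence "incidence x A = incidence x B" for x unfolding iv_def vec_eq_iff by simp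
    thus "A = B" unfolding incidence_def by (auto split: if_splits) (metis zero_neq_one)+
  qed
  obtain c where c: "\<forall>w\<in>iv ` F. 0 \<le> c w" "sum c (iv ` F) = 1" "(\<Sum>w\<in>iv ` F. c w *\<^sub>R w) = u"
    using u unfolding K_def by (subst (asm) convex_hull_finite) auto
  define y where "y W = c (iv W)" for W
  have y_nonneg: "0 \<le> y W" if "W \<in> F" for W using c(1) that by (simp add: y_def)
  have y_sum: "(\<Sum>W\<in>F. y W) = 1"
    using c(2) inj by (simp add: sum.reindex y_def)
  have y_u: "(\<Sum>W\<in>F. incidence x W * y W) = u $ x" for x
  proof -
    have "u = (\<Sum>W\<in>F. y W *\<^sub>R iv W)" using c(3) inj by (simp add: sum.reindex y_def)
    thus ?thesis by (simp add: iv_def mult.commute)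
  qed
  define T where "T = {w :: real^'v. \<forall>x. v < w $ x}"
  have "K \<inter> T = {}"
  proof (rule ccontr)
    assume "K \<inter> T \<noteq> {}"
    then obtain w where w: "w \<in> K" "w \<in> T" by auto
    have "f w \<in> (\<lambda>x. w $ x) ` UNIV" unfolding f_def by (intro Min_in) auto
    hence "v < f w" using w(2) by (auto simp: T_def)
    thus False using max[OF w(1)] by (simp add: v_def)
  qed
  moreover have "convex T"
  proof -
    have "T = (\<Inter>x. {w. v < w $ x})" by (auto simp: T_def)
    moreover have "convex {w :: real^'v. v < w $ x}" for x
    proof -
      have "{w :: real^'v. v < w $ x} = {w. axis x 1 \<bullet> w > v}"
        by (simp add: inner_axis' cart_eq_inner_axis inner_commute)
      thus ?thesis by (simp add: convex_halfspace_gt)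
    qed
    ultimately show ?thesis by (simp add: convex_INT)
  qed
  \<comment> \<open>Test points for the separating functional: a large \<open>t\<close> forces
    \<open>a $ z\<close> to be nonnegative, and \<open>t = 0\<close> with small \<open>h\<close>
    yields \<open>b \<le> v * s\<close>.\<close>
  moreover have T: "(\<chi> x. v + h + (if x = z then t else 0)) \<in> T" if "0 < h" "0 \<le> t" for h t z
    using that by (auto simp: T_def)
  moreover have "T \<noteq> {}" using T[of 1 0 undefined] by auto
  moreover have "convex K" by (simp add: K_def)
  ultimately obtain a b where a: "a \<noteq> 0" and aK: "\<And>w. w \<in> K \<Longrightarrow> a \<bullet> w \<le> b"
    and aT: "\<And>w. w \<in> T \<Longrightarrow> b \<le> a \<bullet> w"
    using separating_hyperplane_sets[of K T] \<open>K \<noteq> {}\<close> by metis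
  define s where "s = (\<Sum>x\<in>UNIV. a $ x)"
  have ineq: "b \<le> (v + h) * s + t * a $ z" if "0 < h" "0 \<le> t" for h t z
  proof -
    have "b \<le> (\<Sum>x\<in>UNIV. a $ x * (v + h + (if x = z then t else 0)))"
      using aT[OF T[OF that, of z]] by (simp add: inner_vec_def)
    also have "\<dots> = (\<Sum>x\<in>UNIV. a $ x * (v + h)) + (\<Sum>x\<in>UNIV. if x = z then a $ x * t else 0)"
      unfolding sum.distrib[symmetric] by (rule sum.cong) (auto simp: algebra_simps)
    also have "\<dots> = (v + h) * s + t * a $ z"
      by (simp add: s_def sum_distrib_left mult.commute)
    finally show ?thesis .
  qed
  have a_nonneg: "0 \<le> a $ z" for z
  proof (rule ccontr)
    assume "\<not> 0 \<le> a $ z"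
    hence neg: "a $ z < 0" by simp
    \<comment> \<open>Chosen so that the right-hand side of \<open>ineq\<close> for
      \<open>h = 1\<close> drops below \<open>b\<close>.\<close>
    define t where "t = (\<bar>b - (v + 1) * s\<bar> + 1) / (- a $ z)"
    have "0 \<le> t" unfolding t_def using neg by (intro divide_nonneg_pos) auto
    moreover have "t * a $ z = - (\<bar>b - (v + 1) * s\<bar> + 1)" using neg by (simp add: t_def)
    ultimately show False using ineq[of 1 t z] by simp
  qed
  have s_pos: "0 < s"
  proof -
    obtain z where "a $ z \<noteq> 0" using a by (auto simp: vec_eq_iff)
    thus ?thesis unfolding s_def using a_nonneg
      by (metis UNIV_I finite less_le sum_pos2)
  qed
  have b: "b \<le> v * s"
  proof (rule field_le_epsilon)
    fix e :: real assume "0 < e"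
    thus "b \<le> v * s + e" using ineq[of "e / s" 0 undefined] s_pos by (simp add: algebra_simps)
  qed
  \<comment> \<open>The normal vector of the hyperplane, normalized to total mass 1, is the optimal
    probability vector on the vertices.\<close>
  define p where "p x = a $ x / s" for x
  have "(\<Sum>x\<in>W. p x) \<le> v" if "W \<in> F" for W
  proof -
    have "iv W \<in> K" unfolding K_def using that by (intro hull_inc) auto
    hence "(\<Sum>x\<in>UNIV. a $ x * incidence x W) \<le> v * s"
      using aK[of "iv W"] b by (simp add: inner_vec_def iv_def)
    moreover have "(\<Sum>x\<in>UNIV. a $ x * incidence x W) = (\<Sum>x\<in>W. a $ x)"
      unfolding incidence_def by (simp add: if_distrib sum.If_cases cong: if_cong)
    ultimately show ?thesis
      using s_pos by (simp add: p_def flip: sum_divide_distrib) (simp add: field_simps)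
  qed
  moreover have "0 \<le> p x" for x using a_nonneg s_pos by (simp add: p_def)
  moreover have "(\<Sum>x\<in>UNIV. p x) = 1"
    using s_pos by (simp add: p_def s_def flip: sum_divide_distrib)
  ultimately show thesis using that[of p v y] y_nonneg y_sum y_u vu by metis
qed

section \<open>Linear programming duality and degree bounds\<close>

lemma compl_independent_iff_vertex_cover: "- C \<in> independent_sets E \<longleftrightarrow> vertex_cover E C"
  by (auto simp: independent_sets_def vertex_cover_def)

text \<open>Weak duality: averaging the covering constraints over \<open>p\<close> and exchanging
  sums bounds \<open>v\<close> times the objective below by 1. For \<open>v > 0\<close> the feasible
  point \<open>y / v\<close> attains the bound \<open>1 / v\<close>; for \<open>v = 0\<close> the
  inequality reads \<open>1 \<le> 0\<close>, so the infimum is over the empty set and equals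
  \<open>\<infinity>\<close>.\<close>

lemma fractional_chromatic_number_eq:
  fixes E :: "'v::finite set set" and v :: real
  assumes p: "\<And>x. 0 \<le> p x" "(\<Sum>x\<in>UNIV. p x) = 1" "\<And>W. W \<in> independent_sets E \<Longrightarrow> (\<Sum>x\<in>W. p x) \<le> v"
    and y: "\<And>W. W \<in> independent_sets E \<Longrightarrow> 0 \<le> y W" "(\<Sum>W\<in>independent_sets E. y W) = 1"
      "\<And>x. v \<le> (\<Sum>W\<in>independent_sets E. incidence x W * y W)"
    and "0 \<le> v"
  shows "fractional_chromatic_number E = (if v = 0 then \<infinity> else ereal (1 / v))"
proof -
  let ?X = "independent_sets E"
  have weak: "1 \<le> v * (\<Sum>W\<in>?X. z W)" if z: "lp_feasible E z" for z
  proof -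
    have "1 = (\<Sum>x\<in>UNIV. p x * 1)" using p(2) by simp
    also have "\<dots> \<le> (\<Sum>x\<in>UNIV. p x * (\<Sum>W\<in>?X. incidence x W * z W))"
      using z p(1) by (intro sum_mono mult_left_mono) (auto simp: lp_feasible_def)
    also have "\<dots> = (\<Sum>W\<in>?X. z W * (\<Sum>x\<in>UNIV. p x * incidence x W))"
      unfolding sum_distrib_left by (subst sum.swap) (simp add: mult_ac)
    also have "\<dots> = (\<Sum>W\<in>?X. z W * (\<Sum>x\<in>W. p x))"
      by (simp add: incidence_def if_distrib sum.If_cases cong: if_cong)
    also have "\<dots> \<le> (\<Sum>W\<in>?X. z W * v)"
      using z p(3) by (intro sum_mono mult_left_mono) (auto simp: lp_feasible_def)
    finally show ?thesis by (simp add: sum_distrib_left mult.commute)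
  qed
  show ?thesis
  proof (cases "v = 0")
    case True
    hence "{z. lp_feasible E z} = {}" using weak by fastforce
    thus ?thesis using True by (simp add: fractional_chromatic_number_def top_ereal_def)
  next
    case False
    hence v: "0 < v" using \<open>0 \<le> v\<close> by simp
    have "lp_feasible E (\<lambda>W. y W / v)"
      unfolding lp_feasible_def
    proof (intro conjI allI ballI)
      fix x
      have "1 \<le> (\<Sum>W\<in>?X. incidence x W * y W) / v" using y(3)[of x] v by simp
      thus "1 \<le> (\<Sum>W\<in>?X. incidence x W * (y W / v))" by (simp add: sum_divide_distrib)
    qed (use y(1) v in simp)
    moreover have "(\<Sum>W\<in>?X. y W / v) = 1 / v" using y(2) by (simp flip: sum_divide_distrib)
    ultimately have "fractional_chromatic_number E \<le> ereal (1 / v)"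
      unfolding fractional_chromatic_number_def by (intro INF_lower2[of "\<lambda>W. y W / v"]) auto
    moreover have "ereal (1 / v) \<le> fractional_chromatic_number E"
      unfolding fractional_chromatic_number_def
    proof (rule INF_greatest)
      fix z assume "z \<in> {z. lp_feasible E z}"
      hence "1 \<le> v * (\<Sum>W\<in>?X. z W)" using weak by simp
      thus "ereal (1 / v) \<le> ereal (\<Sum>W\<in>?X. z W)" using v by (simp add: field_simps)
    qed
    ultimately show ?thesis using False by simp
  qed
qed

text \<open>The complement of an independent set \<open>W\<close> is a cover, so \<open>W\<close>
  carries weight at most the degree of \<open>a\<close> minus \<open>m\<close>. Averaging this over
  \<open>y\<close>, each vertex is counted with probability at least \<open>v\<close>.\<close>

lemma weight_ge_of_covers:
  fixes E :: "'v::finite set set" and v :: real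
  assumes y: "\<And>W. W \<in> independent_sets E \<Longrightarrow> 0 \<le> y W" "(\<Sum>W\<in>independent_sets E. y W) = 1"
      "\<And>x. v \<le> (\<Sum>W\<in>independent_sets E. incidence x W * y W)"
    and a: "\<And>C. vertex_cover E C \<Longrightarrow> m \<le> weight C a"
  shows "real m \<le> (1 - v) * real (weight UNIV a)"
proof -
  let ?X = "independent_sets E" and ?d = "real (weight UNIV a)"
  have "v * ?d = (\<Sum>x\<in>UNIV. real (Poly_Mapping.lookup a x) * v)"
    by (simp add: weight_def sum_distrib_left mult.commute)
  also have "\<dots> \<le> (\<Sum>x\<in>UNIV. real (Poly_Mapping.lookup a x) * (\<Sum>W\<in>?X. incidence x W * y W))"
    using y(3) by (intro sum_mono mult_left_mono) auto
  also have "\<dots> = (\<Sum>W\<in>?X. y W * (\<Sum>x\<in>UNIV. real (Poly_Mapping.lookup a x) * incidence x W))"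
    unfolding sum_distrib_left by (subst sum.swap) (simp add: mult_ac)
  also have "\<dots> = (\<Sum>W\<in>?X. y W * real (weight W a))"
    by (simp add: incidence_def weight_def if_distrib sum.If_cases cong: if_cong)
  also have "\<dots> \<le> (\<Sum>W\<in>?X. y W * (?d - real m))"
  proof (intro sum_mono mult_left_mono)
    fix W assume W: "W \<in> ?X"
    hence "m \<le> weight (- W) a" using a compl_independent_iff_vertex_cover[of "- W" E] by simp
    moreover have "weight UNIV a = weight W a + weight (- W) a"
      unfolding weight_def by (subst sum.union_disjoint[symmetric]) auto
    ultimately show "real (weight W a) \<le> ?d - real m" by simp
  qed (use y(1) in auto)
  also have "\<dots> = ?d - real m" using y(2) by (simp flip: sum_distrib_right)
  finally show ?thesis by (simp add: algebra_simps)
qed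

text \<open>A cover has \<open>p\<close>-measure at least \<open>1 - v\<close>, so scaling
  \<open>p\<close> by \<open>m / (1 - v)\<close> gives it weight at least \<open>m\<close>. Rounding
  up keeps this and raises the degree by at most 1 per vertex.\<close>

lemma exists_light_cover_exponent:
  fixes E :: "'v::finite set set" and v :: real
  assumes p: "\<And>x. 0 \<le> p x" "(\<Sum>x\<in>UNIV. p x) = 1" "\<And>W. W \<in> independent_sets E \<Longrightarrow> (\<Sum>x\<in>W. p x) \<le> v"
    and "v < 1"
  obtains a :: "'v \<Rightarrow>\<^sub>0 nat" where "\<And>C. vertex_cover E C \<Longrightarrow> m \<le> weight C a"
    "real (weight UNIV a) \<le> real m / (1 - v) + real CARD('v)"
proof
  define q where "q x = real m * p x / (1 - v)" for x
  define a :: "'v \<Rightarrow>\<^sub>0 nat" where "a = Abs_poly_mapping (\<lambda>x. nat \<lceil>q x\<rceil>)"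
  have a: "Poly_Mapping.lookup a x = nat \<lceil>q x\<rceil>" for x
    by (simp add: a_def)
  have q0: "0 \<le> q x" for x using p(1) \<open>v < 1\<close> by (simp add: q_def)
  have lower: "q x \<le> real (Poly_Mapping.lookup a x)" for x
    unfolding a by (rule real_nat_ceiling_ge)
  have upper: "real (Poly_Mapping.lookup a x) \<le> q x + 1" for x
    unfolding a using q0[of x] by linarith
  show "m \<le> weight C a" if "vertex_cover E C" for C
  proof -
    have "(\<Sum>x\<in>- C. p x) \<le> v" using that p(3) by (simp add: compl_independent_iff_vertex_cover)
    moreover have "(\<Sum>x\<in>C. p x) + (\<Sum>x\<in>- C. p x) = 1"
      using p(2) by (subst sum.union_disjoint[symmetric]) auto
    ultimately have "1 - v \<le> (\<Sum>x\<in>C. p x)" by simp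
    hence "real m * 1 \<le> real m * ((\<Sum>x\<in>C. p x) / (1 - v))"
      using \<open>v < 1\<close> by (intro mult_left_mono) (auto simp: field_simps)
    also have "\<dots> = (\<Sum>x\<in>C. q x)"
      by (simp add: q_def sum_distrib_left flip: sum_divide_distrib)
    also have "\<dots> \<le> real (weight C a)"
      unfolding weight_def of_nat_sum by (intro sum_mono lower)
    finally show ?thesis by simp
  qed
  have "real (weight UNIV a) \<le> (\<Sum>x\<in>UNIV. q x + 1)"
    unfolding weight_def of_nat_sum by (intro sum_mono upper)
  also have "\<dots> = real m / (1 - v) + real CARD('v)"
    using p(2) by (simp add: sum.distrib q_def flip: sum_divide_distrib sum_distrib_left)
  finally show "real (weight UNIV a) \<le> real m / (1 - v) + real CARD('v)" .
qed

text \<open>The initial degree of the \<open>m\<close>-th symbolic power differs from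
  \<open>m / (1 - v)\<close> by at most the number of vertices, an error that vanishes after
  division by \<open>m\<close>.\<close>

lemma waldschmidt_edge_ideal:
  fixes E :: "'v::{finite,linorder} set set" and v :: real
  assumes p: "\<And>x. 0 \<le> p x" "(\<Sum>x\<in>UNIV. p x) = 1" "\<And>W. W \<in> independent_sets E \<Longrightarrow> (\<Sum>x\<in>W. p x) \<le> v"
    and y: "\<And>W. W \<in> independent_sets E \<Longrightarrow> 0 \<le> y W" "(\<Sum>W\<in>independent_sets E. y W) = 1"
      "\<And>x. v \<le> (\<Sum>W\<in>independent_sets E. incidence x W * y W)"
    and "v < 1"
  shows "waldschmidt (edge_ideal E :: ('v, 'k::idom) mpoly set) = 1 / (1 - v)"
proof -
  let ?S = "symbolic_power (edge_ideal E :: ('v, 'k) mpoly set)"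
  let ?hom = "\<lambda>m d. \<exists>p\<in>?S m. homogeneous d p \<and> p \<noteq> 0"
  have bounds: "real m / (1 - v) \<le> real (alpha (?S m)) \<and>
      real (alpha (?S m)) \<le> real m / (1 - v) + real CARD('v)" for m
  proof -
    obtain a :: "'v \<Rightarrow>\<^sub>0 nat" where a: "\<And>C. vertex_cover E C \<Longrightarrow> m \<le> weight C a"
      "real (weight UNIV a) \<le> real m / (1 - v) + real CARD('v)"
      using exists_light_cover_exponent[OF p \<open>v < 1\<close>] by metis
    have "(monomial a :: ('v, 'k) mpoly) \<in> ?S m" using a(1) by (rule monomial_in_symbolic_power)
    moreover have "homogeneous (weight UNIV a) (monomial a :: ('v, 'k) mpoly)"
      by (simp add: homogeneous_def weight_def)
    moreover have "(monomial a :: ('v, 'k) mpoly) \<noteq> 0" by (simp flip: keys_eq_empty)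
    \<comment> \<open>This witness both bounds the least degree and guarantees that the
      \<open>LEAST\<close> in \<open>alpha\<close> is attained.\<close>
    ultimately have hom: "?hom m (weight UNIV a)" by blast
    have "alpha (?S m) \<le> weight UNIV a" unfolding alpha_def using hom by (rule Least_le)
    moreover have "?hom m (alpha (?S m))" unfolding alpha_def using hom by (rule LeastI)
    then obtain f where f: "f \<in> ?S m" "homogeneous (alpha (?S m)) f" "f \<noteq> 0" by blast
    then obtain b where b: "b \<in> Poly_Mapping.keys f" by (metis all_not_in_conv keys_eq_empty)
    have "real m \<le> (1 - v) * real (weight UNIV b)"
      using y symbolic_power_weight[OF f(1) b] by (rule weight_ge_of_covers)
    \<comment> \<open>By homogeneity, any exponent of \<open>f\<close> has the minimal degree as its
      total weight.\<close>
    moreover have "weight UNIV b = alpha (?S m)" using f(2) b by (simp add: homogeneous_def weight_def)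
    ultimately have "real m / (1 - v) \<le> real (alpha (?S m))"
      using \<open>v < 1\<close> by (simp add: field_simps)
    with a(2) \<open>alpha (?S m) \<le> weight UNIV a\<close> show ?thesis by linarith
  qed
  have "(\<lambda>m. real (alpha (?S m)) / real m) \<longlonglongrightarrow> 1 / (1 - v)"
  proof (rule tendsto_sandwich)
    show "\<forall>\<^sub>F m in sequentially. 1 / (1 - v) \<le> real (alpha (?S m)) / real m"
      using eventually_gt_at_top[of 0]
    proof eventually_elim
      case (elim m)
      have "1 / (1 - v) = (real m / (1 - v)) / real m" using elim by simp
      also have "\<dots> \<le> real (alpha (?S m)) / real m" using bounds[of m] by (intro divide_right_mono) auto
      finally show ?case .
    qed
    show "\<forall>\<^sub>F m in sequentially. real (alpha (?S m)) / real m \<le> 1 / (1 - v) + real CARD('v) / real m"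
      using eventually_gt_at_top[of 0]
    proof eventually_elim
      case (elim m)
      have "real (alpha (?S m)) / real m \<le> (real m / (1 - v) + real CARD('v)) / real m"
        using bounds[of m] by (intro divide_right_mono) auto
      also have "\<dots> = 1 / (1 - v) + real CARD('v) / real m" using elim by (simp add: add_divide_distrib)
      finally show ?case .
    qed
    show "(\<lambda>m. 1 / (1 - v) + real CARD('v) / real m) \<longlonglongrightarrow> 1 / (1 - v)"
      using tendsto_add[OF tendsto_const lim_const_over_n, of "1 / (1 - v)" "real CARD('v)"] by simp
  qed simp
  thus ?thesis unfolding waldschmidt_def by (rule limI)
qed

theorem theorem1p1:
  fixes E :: "'v::{finite,linorder} set set"
    and I :: "('v, 'k::alg_closed_field) mpoly set"
  assumes "hypergraph E"
    and "\<exists>e\<in>E. nontrivial_edge e"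
    and "I = edge_ideal E"
  shows "ereal (waldschmidt I) =
    (if fractional_chromatic_number E = \<infinity> then 1
     else fractional_chromatic_number E / (fractional_chromatic_number E - 1))"
proof -
  let ?X = "independent_sets E"
  obtain e where e: "e \<in> E" "nontrivial_edge e" using assms(2) by blast
  hence "e \<noteq> {}" by (auto simp: nontrivial_edge_def)
  \<comment> \<open>An empty edge would be contained in \<open>e\<close>, hence equal to it. So
    \<open>{}\<close> is independent, which makes the game nonempty and its value
    nonnegative.\<close>
  hence "{} \<notin> E" using assms(1) e(1) unfolding hypergraph_def by blast
  hence empty: "{} \<in> ?X" by (auto simp: independent_sets_def)
  hence "?X \<noteq> {}" by blast
  thus ?thesis
  proof (rule incidence_minimax)
    fix p :: "'v \<Rightarrow> real" and v :: real and y :: "'v set \<Rightarrow> real"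
    assume p: "\<And>x. 0 \<le> p x" "(\<Sum>x\<in>UNIV. p x) = 1" "\<And>W. W \<in> ?X \<Longrightarrow> (\<Sum>x\<in>W. p x) \<le> v"
      and y: "\<And>W. W \<in> ?X \<Longrightarrow> 0 \<le> y W" "(\<Sum>W\<in>?X. y W) = 1" "\<And>x. v \<le> (\<Sum>W\<in>?X. incidence x W * y W)"
    have "0 \<le> v" using p(3)[OF empty] by simp
    \<comment> \<open>An independent set misses a vertex of \<open>e\<close>, so under
      \<open>y\<close> the expected size of its intersection with \<open>e\<close> is at most
      \<open>card e - 1\<close>, whereas it is at least \<open>card e * v\<close>.\<close>
    have "v < 1"
    proof -
      have "real (card e) * v \<le> (\<Sum>x\<in>e. \<Sum>W\<in>?X. incidence x W * y W)"
        using sum_mono[of e "\<lambda>_. v"] y(3) by simp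
      also have "\<dots> = (\<Sum>W\<in>?X. y W * real (card (e \<inter> W)))"
        by (subst sum.swap) (simp add: incidence_def sum.If_cases if_distrib if_distribR Int_def mult.commute cong: if_cong)
      also have "\<dots> \<le> (\<Sum>W\<in>?X. y W * (real (card e) - 1))"
      proof (intro sum_mono mult_left_mono)
        fix W assume "W \<in> ?X"
        hence "e \<inter> W \<subset> e" using e(1) by (auto simp: independent_sets_def)
        hence "card (e \<inter> W) < card e" by (intro psubset_card_mono) auto
        thus "real (card (e \<inter> W)) \<le> real (card e) - 1" by linarith
      qed (use y(1) in auto)
      also have "\<dots> = real (card e) - 1" using y(2) by (simp flip: sum_distrib_right)
      finally have "real (card e) * v < real (card e) * 1" by simp
      thus ?thesis using mult_left_mono[of 1 v "real (card e)"] by linarith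
    qed
    have "waldschmidt I = 1 / (1 - v)"
      unfolding assms(3) using p y \<open>v < 1\<close> by (rule waldschmidt_edge_ideal)
    moreover have "fractional_chromatic_number E = (if v = 0 then \<infinity> else ereal (1 / v))"
      using p y \<open>0 \<le> v\<close> by (rule fractional_chromatic_number_eq)
    moreover have "1 / (1 - v) = (1 / v) / (1 / v - 1)" if "v \<noteq> 0"
      using that \<open>v < 1\<close> by (simp add: field_simps)
    \<comment> \<open>A nonzero denominator lets the extended real quotient be computed as a real
      one.\<close>
    moreover have "1 / v - 1 \<noteq> 0" if "v \<noteq> 0" using that \<open>v < 1\<close> by (simp add: field_simps)
    ultimately show ?thesis by (simp add: one_ereal_def)
  qed
qed

end
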